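(* Let $p$ be a prime with $p\equiv 1 \pmod 3$ and $\mathcal{R}=\mathbb{F}_p+u\mathbb{F}_p+u^2\mathbb{F}_p+u^3\mathbb{F}_p$ with $u^4=u$. Let $\varrho:\mathcal{R}^n\to\mathcal{R}^n$ be the $(1-2u^3)$-constacyclic shift $\varrho(r_0,\dots,r_{n-1})=((1-2u^3)r_{n-1},r_0,\dots,r_{n-2})$, let $\sigma$ be the cyclic shift on $\mathbb{F}_p^{2n}$, $\sigma(v_0,\dots,v_{2n-1})=(v_{2n-1},v_0,\dots,v_{2n-2})$, and let $\Phi:\mathcal{R}^n\to\mathbb{F}_p^{2n}$ be the Gray map $$(r_0,\dots,r_{n-1})\mapsto(-d_0,\dots,-d_{n-1},\,2a_0+d_0,\dots,2a_{n-1}+d_{n-1}),\qquad r_i=a_i+b_iu+c_iu^2+d_iu^3 .$$ Then $\Phi\circ\varrho=\sigma\circ\Phi$.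
   Context: $\mathcal{R}=\mathbb{F}_p[u]/\langle u^4-u\rangle$; every element of $\mathcal{R}$ is uniquely $a+bu+cu^2+du^3$ with $a,b,c,d\in\mathbb{F}_p$. *)

theory Defs
  imports
    "Berlekamp_Zassenhaus.Finite_Field"
    "HOL-Computational_Algebra.Polynomial"
    "HOL-Number_Theory.Cong"
begin

text \<open>The field with p elements is \<^typ>\<open>'p::prime_card mod_ring\<close>, where p is \<open>CARD('p)\<close>.\<close>

definition quot_modulus :: "'p::prime_card mod_ring poly" where
  "quot_modulus = monom 1 4 - monom 1 1"

definition quot_rel :: "'p::prime_card mod_ring poly \<Rightarrow> 'p mod_ring poly \<Rightarrow> bool" where
  "quot_rel f g \<longleftrightarrow> quot_modulus dvd f - g"

lemma equivp_quot_rel: "equivp (quot_rel :: 'p::prime_card mod_ring poly \<Rightarrow> _)"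
proof (rule equivpI)
  show "reflp (quot_rel :: 'p mod_ring poly \<Rightarrow> _)"
    by (auto simp: reflp_def quot_rel_def)
  show "symp (quot_rel :: 'p mod_ring poly \<Rightarrow> _)"
    by (auto simp: symp_def quot_rel_def dvd_diff_commute)
  show "transp (quot_rel :: 'p mod_ring poly \<Rightarrow> _)"
  proof (rule transpI)
    fix f g h :: "'p mod_ring poly"
    assume "quot_rel f g" "quot_rel g h"
    then have "quot_modulus dvd (f - g) + (g - h)"
      unfolding quot_rel_def by (rule dvd_add)
    then show "quot_rel f h" unfolding quot_rel_def by simp
  qed
qed

quotient_type (overloaded) 'p quot_ring = "'p::prime_card mod_ring poly" / quot_rel
  by (rule equivp_quot_rel)

lemma degree_quot_modulus: "degree (quot_modulus :: 'p::prime_card mod_ring poly) = 4"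
proof -
  have "quot_modulus = ([:0, -1, 0, 0, 1:] :: 'p mod_ring poly)"
    by (simp add: quot_modulus_def monom_altdef numeral_eq_Suc)
  then have "degree (quot_modulus :: 'p mod_ring poly) = degree ([:0, -1, 0, 0, 1:] :: 'p mod_ring poly)"
    by (rule arg_cong)
  also have "\<dots> = 4" by simp
  finally show ?thesis .
qed

instantiation quot_ring :: (prime_card) comm_ring_1
begin

lift_definition zero_quot_ring :: "'a quot_ring" is 0 .
lift_definition one_quot_ring :: "'a quot_ring" is 1 .

lift_definition plus_quot_ring :: "'a quot_ring \<Rightarrow> 'a quot_ring \<Rightarrow> 'a quot_ring" is "(+)"
proof -
  fix f f' g g' :: "'a mod_ring poly"
  assume "quot_rel f f'" "quot_rel g g'"
  then have "quot_modulus dvd (f - f') + (g - g')"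
    unfolding quot_rel_def by (rule dvd_add)
  also have "(f - f') + (g - g') = (f + g) - (f' + g')"
    by (simp add: algebra_simps)
  finally show "quot_rel (f + g) (f' + g')" unfolding quot_rel_def .
qed

lift_definition minus_quot_ring :: "'a quot_ring \<Rightarrow> 'a quot_ring \<Rightarrow> 'a quot_ring" is "(-)"
proof -
  fix f f' g g' :: "'a mod_ring poly"
  assume "quot_rel f f'" "quot_rel g g'"
  then have "quot_modulus dvd (f - f') - (g - g')"
    unfolding quot_rel_def by (rule dvd_diff)
  also have "(f - f') - (g - g') = (f - g) - (f' - g')"
    by (simp add: algebra_simps)
  finally show "quot_rel (f - g) (f' - g')" unfolding quot_rel_def .
qed

lift_definition uminus_quot_ring :: "'a quot_ring \<Rightarrow> 'a quot_ring" is uminus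
proof -
  fix f f' :: "'a mod_ring poly"
  assume "quot_rel f f'"
  then have "quot_modulus dvd - (f - f')"
    unfolding quot_rel_def by (simp only: dvd_minus_iff)
  also have "- (f - f') = - f - (- f')" by simp
  finally show "quot_rel (- f) (- f')" unfolding quot_rel_def .
qed

lift_definition times_quot_ring :: "'a quot_ring \<Rightarrow> 'a quot_ring \<Rightarrow> 'a quot_ring" is "(*)"
proof -
  fix f f' g g' :: "'a mod_ring poly"
  assume "quot_rel f f'" "quot_rel g g'"
  then have "quot_modulus dvd (f - f') * g + f' * (g - g')"
    unfolding quot_rel_def by simp
  also have "(f - f') * g + f' * (g - g') = f * g - f' * g'"
    by (simp add: algebra_simps)
  finally show "quot_rel (f * g) (f' * g')" unfolding quot_rel_def .
qed

instance
proof
  show "(0 :: 'a quot_ring) \<noteq> 1"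
  proof transfer
    show "\<not> quot_rel 0 (1 :: 'a mod_ring poly)"
      unfolding quot_rel_def using degree_quot_modulus[where 'p='a]
      by (auto dest!: dvd_imp_degree_le)
  qed
qed (transfer; simp add: quot_rel_def algebra_simps)+

end

definition quot_const :: "'p::prime_card mod_ring \<Rightarrow> 'p quot_ring" where
  "quot_const c = abs_quot_ring [:c:]"

definition quot_u :: "'p::prime_card quot_ring" where
  "quot_u = abs_quot_ring (monom 1 1)"

lemma quot_u_power_4: "(quot_u :: 'p::prime_card quot_ring) ^ 4 = quot_u"
proof -
  have "(quot_u :: 'p quot_ring) * (quot_u * (quot_u * quot_u)) = quot_u"
    by (simp add: quot_u_def times_quot_ring.abs_eq quot_ring.abs_eq_iff quot_rel_def
        quot_modulus_def mult_monom numeral_eq_Suc)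
  then show ?thesis by (simp add: numeral_eq_Suc)
qed

lemma quot_const_simps:
  "quot_const 0 = 0"
  "quot_const 1 = 1"
  "quot_const (x + y) = quot_const x + quot_const y"
  "quot_const (- x) = - quot_const x"
  "quot_const (x - y) = quot_const x - quot_const y"
  "quot_const (x * y) = quot_const x * quot_const y"
  by (simp_all add: quot_const_def zero_quot_ring.abs_eq one_quot_ring.abs_eq
      plus_quot_ring.abs_eq minus_quot_ring.abs_eq uminus_quot_ring.abs_eq
      times_quot_ring.abs_eq one_pCons mult.commute)

definition quot_comb ::
  "'p::prime_card mod_ring \<Rightarrow> 'p mod_ring \<Rightarrow> 'p mod_ring \<Rightarrow> 'p mod_ring \<Rightarrow> 'p quot_ring" where
  "quot_comb a b c d =
     quot_const a + quot_const b * quot_u + quot_const c * quot_u ^ 2 + quot_const d * quot_u ^ 3"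

lemma quot_comb_abs: "quot_comb a b c d = abs_quot_ring [:a, b, c, d:]"
proof -
  have "quot_const a + quot_const b * quot_u + quot_const c * (quot_u * quot_u) +
      quot_const d * (quot_u * (quot_u * quot_u)) = abs_quot_ring [:a, b, c, d:]"
    by (simp add: quot_const_def quot_u_def plus_quot_ring.abs_eq times_quot_ring.abs_eq
        monom_altdef)
  then show ?thesis by (simp add: quot_comb_def numeral_eq_Suc)
qed

lemma quot_comb_surj: "\<exists>a b c d. r = quot_comb a b c d"
proof -
  obtain f where r: "r = abs_quot_ring f" by (metis Quotient_abs_rep Quotient_quot_ring)
  define g where "g = f mod quot_modulus"
  have "quot_modulus \<noteq> (0 :: 'a mod_ring poly)"
    using degree_quot_modulus[where 'p='a] by auto
  then have "degree g < 4"
    using degree_mod_less[of quot_modulus f] by (auto simp: g_def degree_quot_modulus)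
  then have "g = [:coeff g 0, coeff g 1, coeff g 2, coeff g 3:]"
    by (intro poly_eqI) (auto simp: coeff_pCons coeff_eq_0 numeral_eq_Suc split: nat.splits)
  moreover have "quot_rel f g" unfolding quot_rel_def g_def
    by (simp add: minus_mod_eq_mult_div)
  ultimately have "r = quot_comb (coeff g 0) (coeff g 1) (coeff g 2) (coeff g 3)"
    unfolding r quot_comb_abs by (metis quot_ring.abs_eq_iff)
  then show ?thesis by blast
qed

lemma quot_comb_eq_iff:
  "quot_comb a b c d = quot_comb a' b' c' d' \<longleftrightarrow> a = a' \<and> b = b' \<and> c = c' \<and> d = d'"
proof
  assume "quot_comb a b c d = quot_comb a' b' c' d'"
  then have "quot_modulus dvd [:a - a', b - b', c - c', d - d':]"
    by (simp add: quot_comb_abs quot_ring.abs_eq_iff quot_rel_def)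
  moreover have "degree [:a - a', b - b', c - c', d - d':] < degree (quot_modulus :: 'a mod_ring poly)"
    by (simp add: degree_quot_modulus)
  ultimately have "[:a - a', b - b', c - c', d - d':] = 0"
    by (meson dvd_imp_degree_le leD)
  then show "a = a' \<and> b = b' \<and> c = c' \<and> d = d'" by (simp split: if_splits)
qed simp

text \<open>The coefficients a and d in the unique representation a + b u + c u^2 + d u^3.\<close>

definition coeff_a :: "'p::prime_card quot_ring \<Rightarrow> 'p mod_ring" where
  "coeff_a r = (THE a. \<exists>b c d. r = quot_comb a b c d)"

definition coeff_d :: "'p::prime_card quot_ring \<Rightarrow> 'p mod_ring" where
  "coeff_d r = (THE d. \<exists>a b c. r = quot_comb a b c d)"

lemma coeff_a_quot_comb: "coeff_a (quot_comb a b c d) = a"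
  unfolding coeff_a_def by (auto simp: quot_comb_eq_iff)

lemma coeff_d_quot_comb: "coeff_d (quot_comb a b c d) = d"
  unfolding coeff_d_def by (auto simp: quot_comb_eq_iff)

text \<open>
  Vectors are lists. The shifts below are meant for nonempty lists only, since \<^const>\<open>last\<close>
  is unspecified on the empty list.
\<close>

definition constacyclic_shift :: "'a::monoid_mult \<Rightarrow> 'a list \<Rightarrow> 'a list" where
  "constacyclic_shift l r = (l * last r) # butlast r"

definition cyclic_shift :: "'a list \<Rightarrow> 'a list" where
  "cyclic_shift v = last v # butlast v"

definition varrho :: "'p::prime_card quot_ring list \<Rightarrow> 'p quot_ring list" where
  "varrho = constacyclic_shift (1 - 2 * quot_u ^ 3)"

definition gray_map :: "'p::prime_card quot_ring list \<Rightarrow> 'p mod_ring list" where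
  "gray_map r = map (\<lambda>x. - coeff_d x) r @ map (\<lambda>x. 2 * coeff_a x + coeff_d x) r"

lemma length_gray_map: "length (gray_map r) = 2 * length r"
  by (simp add: gray_map_def)

lemma length_varrho: "r \<noteq> [] \<Longrightarrow> length (varrho r) = length r"
  by (simp add: varrho_def constacyclic_shift_def)

lemma length_cyclic_shift: "v \<noteq> [] \<Longrightarrow> length (cyclic_shift v) = length v"
  by (simp add: cyclic_shift_def)

end

theory Submission
  imports Defs
begin

text \<open>
  Since \<open>u\<^sup>3\<close> acts as the identity on \<open>u\<close>, \<open>u\<^sup>2\<close> and \<open>u\<^sup>3\<close>, multiplication by
  \<open>1 - 2u\<^sup>3\<close> fixes \<open>a\<close> and sends \<open>d\<close> to \<open>-(2a + d)\<close>, so it swaps the two Gray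
  coordinates \<open>-d\<close> and \<open>2a + d\<close>. This is the swap that the cyclic shift
  performs where the two halves of the Gray image meet.
\<close>

lemma one_minus_2_u3_times_quot_comb:
  "(1 - 2 * quot_u ^ 3) * quot_comb a b c d = quot_comb a (- b) (- c) (- (2 * a + d))"
proof -
  define u v w where "u = (quot_u :: 'a quot_ring)" and "v = u ^ 2" and "w = u ^ 3"
  define A B C D where "A = quot_const a" and "B = quot_const b"
    and "C = quot_const c" and "D = quot_const d"
  have w_u: "w * u = u"
    using quot_u_power_4 unfolding w_def u_def by (simp flip: power_Suc2)
  then have w_v: "w * v = v"
    unfolding v_def by (simp only: power2_eq_square flip: mult.assoc)
  \<comment> \<open>Writing the second factor \<open>w\<close> as \<open>v * u\<close> reduces this
    to \<open>w_v\<close>.\<close>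
  have "w * w = w * v * u"
    unfolding v_def w_def by (simp only: power2_eq_square power3_eq_cube mult.assoc)
  also have "\<dots> = w"
    unfolding w_v by (simp add: v_def w_def power2_eq_square power3_eq_cube)
  finally have w_w: "w * w = w" .
  have "(1 - 2 * w) * (A + B * u + C * v + D * w) =
      A + B * (u - 2 * (w * u)) + C * (v - 2 * (w * v)) + D * (w - 2 * (w * w)) - 2 * A * w"
    by (simp only: algebra_simps mult_1_left mult_1_right)
  \<comment> \<open>Doubling becomes \<open>A + A\<close> so that additivity of
    \<open>quot_const\<close> applies; \<open>mult_2\<close> later splits \<open>2 * a\<close>
    alike.\<close>
  also have "\<dots> = A + - B * u + - C * v + - (A + A + D) * w"
    unfolding w_u w_v w_w mult_2 by (simp add: ring_distribs)
  finally show ?thesis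
    unfolding quot_comb_def mult_2 quot_const_simps
    by (simp only: mult_2 u_def v_def w_def A_def B_def C_def D_def)
qed

lemma
  shows coeff_a_one_minus_2_u3_times: "coeff_a ((1 - 2 * quot_u ^ 3) * r) = coeff_a r"
    and coeff_d_one_minus_2_u3_times:
      "coeff_d ((1 - 2 * quot_u ^ 3) * r) = - (2 * coeff_a r + coeff_d r)"
proof -
  obtain a b c d where r: "r = quot_comb a b c d"
    using quot_comb_surj by blast
  show "coeff_a ((1 - 2 * quot_u ^ 3) * r) = coeff_a r"
    by (simp only: r one_minus_2_u3_times_quot_comb coeff_a_quot_comb)
  show "coeff_d ((1 - 2 * quot_u ^ 3) * r) = - (2 * coeff_a r + coeff_d r)"
    by (simp only: r one_minus_2_u3_times_quot_comb coeff_a_quot_comb coeff_d_quot_comb)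
qed

lemma gray_map_varrho:
  assumes "r \<noteq> []"
  shows "gray_map (varrho r) = cyclic_shift (gray_map r)"
proof -
  \<comment> \<open>On both sides \<open>2a + d\<close> of \<open>x\<close> comes first, and
    \<open>-d\<close> of \<open>x\<close> moves from the end of the first half to the start of the
    second.\<close>
  obtain xs x where r: "r = xs @ [x]"
    using assms by (cases r rule: rev_cases) auto
  show ?thesis
    unfolding r
    by (simp add: gray_map_def varrho_def constacyclic_shift_def cyclic_shift_def butlast_append
        coeff_a_one_minus_2_u3_times coeff_d_one_minus_2_u3_times)
qed

theorem theorem1:
  fixes p n :: nat
  assumes "CARD('p::prime_card) = p" and "prime p" and "[p = 1] (mod 3)" and "n \<ge> 1"
  shows "\<forall>r \<in> {r :: 'p quot_ring list. length r = n}.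
           (gray_map \<circ> varrho) r = (cyclic_shift \<circ> gray_map) r"
  \<comment> \<open>The bound on \<open>n\<close> excludes the empty list, where \<open>last\<close>
    is unspecified.\<close>
  using \<open>n \<ge> 1\<close> by (auto intro!: gray_map_varrho)

end
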